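(* Let $k, l \geq 1$ be integers, and let $F$ be a monotone exact linear CNF formula that is $k$-uniform and $l$-regular, with $k \not\equiv 1 \pmod{l}$. Then $F$ is x-unsat.
   Context: A monotone CNF formula $F$ is a finite non-empty set (conjunction) of clauses in which every clause is a finite non-empty set (disjunction) of positive literals, i.e. of (unnegated) Boolean variables. $V(C)$ is the set of variables occurring in the clause $C$, and $V(F)$ the set of variables occurring in $F$. $F$ is exact linear if any two distinct clauses $C, C' \in F$ satisfy $|V(C) \cap V(C')| = 1$. $F$ is $k$-uniform if every clause of $F$ contains exactly $k$ literals, and $l$-regular if every variable $x \in V(F)$ occurs in exactly $l$ clauses of $F$. $F$ is x-sat if there is a truth assignment $V(F) \to \{0,1\}$ under which exactly one literal in each clause of $F$ is true; otherwise $F$ is x-unsat. *)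

theory Defs
  imports "HOL-Number_Theory.Cong"
begin

text \<open>Since only positive literals occur, a literal is identified with its variable;
  hence a clause is a set of variables, and coincides with its own variable set.\<close>

type_synonym 'v clause = "'v set"
type_synonym 'v cnf = "'v clause set"

definition monotone_cnf :: "'v cnf \<Rightarrow> bool" where
  "monotone_cnf F \<longleftrightarrow> finite F \<and> F \<noteq> {} \<and> (\<forall>C\<in>F. finite C \<and> C \<noteq> {})"

definition vars :: "'v cnf \<Rightarrow> 'v set" where
  "vars F = \<Union>F"

definition exact_linear :: "'v cnf \<Rightarrow> bool" where
  "exact_linear F \<longleftrightarrow> (\<forall>C\<in>F. \<forall>C'\<in>F. C \<noteq> C' \<longrightarrow> card (C \<inter> C') = 1)"

definition uniform :: "nat \<Rightarrow> 'v cnf \<Rightarrow> bool" where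
  "uniform k F \<longleftrightarrow> (\<forall>C\<in>F. card C = k)"

definition regular :: "nat \<Rightarrow> 'v cnf \<Rightarrow> bool" where
  "regular l F \<longleftrightarrow> (\<forall>x\<in>vars F. card {C \<in> F. x \<in> C} = l)"

text \<open>Assignments are total functions; only their values on \<^term>\<open>vars F\<close> matter,
  as every clause of \<^term>\<open>F\<close> is contained in \<^term>\<open>vars F\<close>.\<close>

definition x_sat :: "'v cnf \<Rightarrow> bool" where
  "x_sat F \<longleftrightarrow> (\<exists>t :: 'v \<Rightarrow> bool. \<forall>C\<in>F. \<exists>!x. x \<in> C \<and> t x)"

definition x_unsat :: "'v cnf \<Rightarrow> bool" where
  "x_unsat F \<longleftrightarrow> \<not> x_sat F"

end

theory Submission
  imports Defs
begin

text \<open>Count incidences between variables and clauses twice. Over the variables of a fixed clause,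
  exact linearity gives \<open>k * l = k + (card F - 1)\<close>; over the true variables of an assignment that
  satisfies exactly one literal per clause, \<open>card F\<close> is a multiple of \<open>l\<close>. Modulo \<open>l\<close> this
  leaves \<open>k \<equiv> 1\<close>.\<close>

text \<open>Both sides count the pairs of \<open>x\<close> in \<open>A\<close> and \<open>C\<close>
  in \<open>F\<close> with \<open>x\<close> in \<open>C\<close>.\<close>

lemma sum_occurrences:
  assumes "finite A" "finite F"
  shows "(\<Sum>x\<in>A. card {C \<in> F. x \<in> C}) = (\<Sum>C\<in>F. card (A \<inter> C))"
  using assms by (intro sum_multicount_gen) (auto simp: Int_def)

lemma sum_occurrences_regular:
  assumes "finite A" "finite F" "A \<subseteq> vars F" "regular l F"
  shows "(\<Sum>C\<in>F. card (A \<inter> C)) = l * card A"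
proof -
  have "(\<Sum>x\<in>A. card {C \<in> F. x \<in> C}) = (\<Sum>x\<in>A. l)"
    using assms by (intro sum.cong) (auto simp: regular_def)
  then show ?thesis
    using assms by (simp add: sum_occurrences)
qed

text \<open>Take \<open>A\<close> to be a clause \<open>C\<close> in the double count:
  \<open>C\<close> meets itself in \<open>k\<close> variables and each other clause in exactly one.
  The additive form avoids truncated subtraction on naturals.\<close>

lemma card_exact_linear:
  assumes "monotone_cnf F" "exact_linear F" "uniform k F" "regular l F"
  shows "k + card F = l * k + 1"
proof -
  from assms(1) obtain C where C: "C \<in> F"
    and fin: "finite F" "finite C"
    by (auto simp: monotone_cnf_def)
  have k: "card C = k"
    using C assms(3) by (simp add: uniform_def)
  have "l * k = (\<Sum>D\<in>F. card (C \<inter> D))"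
    using sum_occurrences_regular[OF fin(2,1) _ assms(4)] C k by (simp add: vars_def Sup_upper)
  also have "\<dots> = card C + (\<Sum>D\<in>F - {C}. card (C \<inter> D))"
    using C fin by (simp add: sum.remove)
  also have "(\<Sum>D\<in>F - {C}. card (C \<inter> D)) = (\<Sum>D\<in>F - {C}. 1)"
    using C assms(2) by (intro sum.cong) (auto simp: exact_linear_def)
  finally have "l * k = k + card (F - {C})"
    using k by simp
  then show ?thesis
    using card_Suc_Diff1[OF fin(1) C] by simp
qed

text \<open>Each clause contains exactly one true variable and each true variable lies in
  \<open>l\<close> clauses, so the true variables split \<open>F\<close> into classes of size
  \<open>l\<close>.\<close>

lemma x_sat_regular_dvd_card:
  assumes "monotone_cnf F" "regular l F" "x_sat F"
  shows "l dvd card F"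
proof -
  from assms(3) obtain t where t: "\<forall>C\<in>F. \<exists>!x. x \<in> C \<and> t x"
    unfolding x_sat_def ..
  define T where "T = {x \<in> vars F. t x}"
  have fin: "finite F" "finite T"
    using assms(1) by (auto simp: T_def monotone_cnf_def vars_def)
  have "card (T \<inter> C) = 1" if "C \<in> F" for C
  proof -
    from bspec[OF t that]
    obtain x where x: "x \<in> C" "t x" and unique: "\<forall>y. y \<in> C \<and> t y \<longrightarrow> y = x"
      by (rule ex1E) blast
    have "x \<in> T"
      using x that by (auto simp: T_def vars_def)
    then have "T \<inter> C = {x}"
      using x unique unfolding T_def by blast
    then show ?thesis by simp
  qed
  then have "card F = (\<Sum>C\<in>F. card (T \<inter> C))"
    by simp
  also have "\<dots> = l * card T"
    by (rule sum_occurrences_regular[OF fin(2,1) _ assms(2)]) (auto simp: T_def)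
  finally show ?thesis by simp
qed

theorem theorem5:
  fixes k l :: nat and F :: "'v cnf"
  assumes "k \<ge> 1" and "l \<ge> 1"
    and "monotone_cnf F"
    and "exact_linear F"
    and "uniform k F"
    and "regular l F"
    and "\<not> [k = 1] (mod l)"
  shows "x_unsat F"
  unfolding x_unsat_def
proof
  assume "x_sat F"
  then obtain s where "card F = l * s"
    using x_sat_regular_dvd_card assms(3,6) by blast
  \<comment> \<open>Both sides are arranged as a term plus a multiple of \<open>l\<close>, which
    reduction modulo \<open>l\<close> removes.\<close>
  with card_exact_linear[OF assms(3-6)] have "k + l * s = 1 + l * k"
    by simp
  then have "(k + l * s) mod l = (1 + l * k) mod l"
    by (rule arg_cong)
  then have "[k = 1] (mod l)"
    unfolding cong_def by (simp only: mod_mult_self2)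
  with assms(7) show False ..
qed

end
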